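(* Let $n,d\in\mathbb{N}$, $\lambda\ge1$ and $\beta\in(0,1]$. If $\mathsf{M}\colon\mathbb{R}^+\times(\mathbb{R}^d)^n\to\mathbb{R}^d$ is a $(\lambda,\beta)$-estimator for averaging and $\mathsf{M}(\gamma,\cdot)$ is $\left(1,\frac{\beta}{4n}\right)$-differentially private for every $\gamma\ge0$, then $$n\geq\Omega\!\left(\frac{\sqrt d/\lambda}{\log^{1.5}\!\left(\frac{d}{\beta\lambda}\right)}\right).$$
   Context: A mechanism $\mathsf{M}$ on datasets $(x_1,\dots,x_n)$ is $(\varepsilon,\delta)$-differentially private if for every two datasets differing in exactly one element and every set $T$ of outputs, $\Pr[\mathsf{M}(X)\in T]\le e^{\varepsilon}\Pr[\mathsf{M}(X')\in T]+\delta$. A mechanism $\mathsf{M}\colon\mathbb{R}^+\times(\mathbb{R}^d)^n\to\mathbb{R}^d$ is a $(\lambda,\beta)$-estimator for averaging if for every $\gamma\ge0$ and every $x_1,\dots,x_n\in\{-1,1\}^d$ with $\max_{i,j\in[n]}\|x_i-x_j\|_2\le\gamma$, it holds that $\Pr\left[\left\|\mathsf{M}(\gamma,x_1,\dots,x_n)-\frac1n\sum_{i=1}^n x_i\right\|_2\le\lambda\gamma\right]\ge\beta$. The $\Omega(\cdot)$ hides a positive absolute constant.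
   Formalization: The logarithm is read as ln(max(e, d/(βλ))), since the bound as written is undefined for d/(βλ) ≤ 1 and fails as d/(βλ) → 1+ (e.g. d=λ=1, β→1, n fixed); n ≥ 1 is assumed so that the average is defined. *)

theory Defs
  imports "HOL-Probability.Probability"
begin

text \<open>Vectors in R^d are functions nat => real, extensional outside {..<d}.
  A dataset (x_1,...,x_n) in (R^d)^n is a function nat => (nat => real),
  extensional outside {..<n} (index i < n stands for x_(i+1)).\<close>

definition vecs :: "nat \<Rightarrow> (nat \<Rightarrow> real) set" where
  "vecs d = Pi\<^sub>E {..<d} (\<lambda>_. UNIV)"

definition datasets :: "nat \<Rightarrow> nat \<Rightarrow> (nat \<Rightarrow> nat \<Rightarrow> real) set" where
  "datasets n d = Pi\<^sub>E {..<n} (\<lambda>_. vecs d)"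

definition out_space :: "nat \<Rightarrow> (nat \<Rightarrow> real) measure" where
  "out_space d = Pi\<^sub>M {..<d} (\<lambda>_. borel)"

definition edist :: "nat \<Rightarrow> (nat \<Rightarrow> real) \<Rightarrow> (nat \<Rightarrow> real) \<Rightarrow> real" where
  "edist d x y = sqrt (\<Sum>j<d. (x j - y j)\<^sup>2)"

definition avg :: "nat \<Rightarrow> nat \<Rightarrow> (nat \<Rightarrow> nat \<Rightarrow> real) \<Rightarrow> (nat \<Rightarrow> real)" where
  "avg n d X = (\<lambda>j. if j < d then (\<Sum>i<n. X i j) / real n else undefined)"

definition neighbors :: "nat \<Rightarrow> nat \<Rightarrow> (nat \<Rightarrow> nat \<Rightarrow> real) \<Rightarrow> (nat \<Rightarrow> nat \<Rightarrow> real) \<Rightarrow> bool" where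
  "neighbors n d X X' \<longleftrightarrow> X \<in> datasets n d \<and> X' \<in> datasets n d \<and>
     (\<exists>i<n. X i \<noteq> X' i \<and> (\<forall>k<n. k \<noteq> i \<longrightarrow> X k = X' k))"

text \<open>A randomized mechanism maps each dataset to a probability distribution
  (a probability measure) on R^d.\<close>
definition is_mechanism :: "nat \<Rightarrow> nat \<Rightarrow> ((nat \<Rightarrow> nat \<Rightarrow> real) \<Rightarrow> (nat \<Rightarrow> real) measure) \<Rightarrow> bool" where
  "is_mechanism n d A \<longleftrightarrow> (\<forall>X \<in> datasets n d. prob_space (A X) \<and> sets (A X) = sets (out_space d))"

definition diff_private :: "nat \<Rightarrow> nat \<Rightarrow> real \<Rightarrow> real \<Rightarrow>
    ((nat \<Rightarrow> nat \<Rightarrow> real) \<Rightarrow> (nat \<Rightarrow> real) measure) \<Rightarrow> bool" where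
  "diff_private n d \<epsilon> \<delta> A \<longleftrightarrow> is_mechanism n d A \<and>
     (\<forall>X X'. neighbors n d X X' \<longrightarrow>
        (\<forall>T \<in> sets (out_space d). measure (A X) T \<le> exp \<epsilon> * measure (A X') T + \<delta>))"

definition averaging_estimator :: "nat \<Rightarrow> nat \<Rightarrow> real \<Rightarrow> real \<Rightarrow>
    (real \<Rightarrow> (nat \<Rightarrow> nat \<Rightarrow> real) \<Rightarrow> (nat \<Rightarrow> real) measure) \<Rightarrow> bool" where
  "averaging_estimator n d lam \<beta> M \<longleftrightarrow>
     (\<forall>\<gamma>\<ge>0. \<forall>X \<in> datasets n d.
        (\<forall>i<n. \<forall>j<d. X i j \<in> {-1, 1}) \<and> (\<forall>i<n. \<forall>k<n. edist d (X i) (X k) \<le> \<gamma>) \<longrightarrow>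
        measure (M \<gamma> X) {y \<in> space (M \<gamma> X). edist d y (avg n d X) \<le> lam * \<gamma>} \<ge> \<beta>)"

end

theory Submission
  imports Defs
begin

text \<open>
  The proof is a fingerprinting argument. Every coordinate is an independent random column, a set
  of users among n users and one spare user who takes no part in the data set. With probability
  1 - \<rho> a column is constant; otherwise its size k has probability proportional to
  1/k + 1/(n+1-k), and the set is uniform among those of size k. Constant columns play the role of
  padding: taking \<rho> of order 1/lam^2, the data set has small diameter, so an accurate output has
  the right sign on most constant columns.

  A user's score in a mixed column is the user's membership minus the average membership, and
  +h or -h in a full or empty column. The weights and h are chosen so that, for every sign pattern,
  the scores of all users cancel on mixed columns, while the score of the spare user has conditional
  mean zero given what the mechanism sees. An accurate output therefore gives some user a high
  score, whereas the spare user's score exceeds the same threshold only with exponentially small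
  probability. Exchanging a user with the spare one, privacy transfers this bound to every user.
\<close>

section \<open>Random columns and their scores\<close>

text \<open>The mass of one set, where index \<open>n\<close> is the spare user. Since 1/(k(n+1-k))
  = (1/k + 1/(n+1-k))/(n+1), the binomial in the denominator spreads the mass of size k evenly, and
  \<open>2 * harm n\<close> normalises the mixed sizes to \<rho>.\<close>

definition col_weight :: "nat \<Rightarrow> real \<Rightarrow> nat set \<Rightarrow> real" where
  "col_weight n \<rho> S = (if card S = 0 \<or> card S = Suc n then (1 - \<rho>) / 2
     else \<rho> * real (Suc n) /
       (2 * harm n * real (card S) * (real (Suc n) - real (card S)) * real (Suc n choose card S)))"

text \<open>The value forced by the mean-zero condition for the spare user when all other users agree.\<close>

definition marked_score :: "nat \<Rightarrow> real \<Rightarrow> real" where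
  "marked_score n \<rho> = \<rho> / (real (Suc n) * (1 - \<rho>) * harm n)"

definition col_score :: "nat \<Rightarrow> real \<Rightarrow> nat \<Rightarrow> nat set \<Rightarrow> real" where
  "col_score n \<rho> i S = (if card S = 0 then - marked_score n \<rho>
     else if card S = Suc n then marked_score n \<rho>
     else of_bool (i \<in> S) - real (card S) / real (Suc n))"

definition mixed :: "nat \<Rightarrow> nat set \<Rightarrow> bool" where
  "mixed n S \<longleftrightarrow> card S \<noteq> 0 \<and> card S \<noteq> Suc n"

lemma sum_Pow_card:
  fixes f :: "nat \<Rightarrow> real"
  assumes "finite A"
  shows "(\<Sum>S\<in>Pow A. f (card S)) = (\<Sum>k\<le>card A. real (card A choose k) * f k)"
proof -
  have "(\<Sum>S\<in>Pow A. f (card S)) = (\<Sum>k\<le>card A. \<Sum>S\<in>{S\<in>Pow A. card S = k}. f (card S))"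
    using assms by (intro sum.group[symmetric]) (auto intro: card_mono)
  also have "\<dots> = (\<Sum>k\<le>card A. real (card {S\<in>Pow A. card S = k}) * f k)"
    by (intro sum.cong) auto
  also have "\<dots> = (\<Sum>k\<le>card A. real (card A choose k) * f k)"
    using n_subsets[OF assms] by simp
  finally show ?thesis .
qed

section \<open>Total mass of the column distribution\<close>

lemma harm_ge_1: "n \<ge> 1 \<Longrightarrow> harm n \<ge> (1::real)"
  using harm_mono[of 1 n, where 'a=real] by (simp add: harm_def)

text \<open>Partial fractions split each term into 1/k and 1/(n+1-k), up to the factor 1/(n+1); both
  parts sum to \<open>harm n\<close>, the second after reversing the order.\<close>

lemma sum_inverse_ends:
  "(\<Sum>k=1..n. 1 / (real k * (real (Suc n) - real k))) = 2 * harm n / real (Suc n)"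
proof -
  have "(\<Sum>k=1..n. 1 / (real k * (real (Suc n) - real k)))
      = (\<Sum>k=1..n. (inverse (real k) + inverse (real (Suc n - k))) / real (Suc n))"
  proof (rule sum.cong[OF refl])
    fix k assume k: "k \<in> {1..n}"
    have "1 / (a * b) = (inverse a + inverse b) / (a + b)" if "a > 0" "b > 0" for a b :: real
      using that add_pos_pos[OF that] by (simp add: divide_simps)
    from this[of "real k" "real (Suc n) - real k"] k
    show "1 / (real k * (real (Suc n) - real k))
      = (inverse (real k) + inverse (real (Suc n - k))) / real (Suc n)"
      by (simp add: of_nat_diff)
  qed
  also have "\<dots> = (harm n + (\<Sum>k=1..n. inverse (real (Suc n - k)))) / real (Suc n)"
    by (simp add: sum_divide_distrib[symmetric] sum.distrib harm_def)
  also have "(\<Sum>k=1..n. inverse (real (Suc n - k))) = harm n"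
    unfolding harm_def by (rule sum.reindex_bij_witness[of _ "\<lambda>k. Suc n - k" "\<lambda>k. Suc n - k"]) auto
  finally show ?thesis by simp
qed

lemma card_subset_atMost: "S \<subseteq> {..n::nat} \<Longrightarrow> card S \<le> Suc n"
  using card_mono[of "{..n}" S] by simp

lemma col_weight_nonneg:
  assumes "S \<subseteq> {..n}" "0 \<le> \<rho>" "\<rho> \<le> 1"
  shows "0 \<le> col_weight n \<rho> S"
  using assms card_subset_atMost[OF assms(1)]
  by (auto simp: col_weight_def harm_nonneg intro!: divide_nonneg_nonneg mult_nonneg_nonneg)

text \<open>Grouping the sets by size cancels the binomial coefficient and leaves the sum of
  \<open>sum_inverse_ends\<close>.\<close>

lemma col_weight_mixed:
  assumes "n \<ge> 1"
  shows "(\<Sum>S\<in>Pow {..n}. of_bool (mixed n S) * col_weight n \<rho> S) = \<rho>"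
proof -
  define g where "g k = (if k = 0 \<or> k = Suc n then 0 else \<rho> * real (Suc n) /
       (2 * harm n * real k * (real (Suc n) - real k) * real (Suc n choose k)))" for k
  have H: "harm n \<noteq> (0::real)" using harm_ge_1[OF assms] by linarith
  have "(\<Sum>S\<in>Pow {..n}. of_bool (mixed n S) * col_weight n \<rho> S) = (\<Sum>S\<in>Pow {..n}. g (card S))"
    by (intro sum.cong) (auto simp: mixed_def col_weight_def g_def)
  also have "\<dots> = (\<Sum>k\<le>Suc n. real (Suc n choose k) * g k)"
    using sum_Pow_card[of "{..n}" g] by simp
  also have "\<dots> = (\<Sum>k=1..n. real (Suc n choose k) * g k)"
    by (rule sum.mono_neutral_right) (auto simp: g_def)
  also have "\<dots> = (\<Sum>k=1..n. \<rho> * real (Suc n) / (2 * harm n) * (1 / (real k * (real (Suc n) - real k))))"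
  proof (rule sum.cong[OF refl])
    fix k assume "k \<in> {1..n}"
    then have "real (Suc n choose k) \<noteq> 0" "k \<noteq> 0" "k \<noteq> Suc n"
      by (auto simp del: binomial_Suc_Suc)
    then show "real (Suc n choose k) * g k
      = \<rho> * real (Suc n) / (2 * harm n) * (1 / (real k * (real (Suc n) - real k)))"
      unfolding g_def by (simp del: binomial_Suc_Suc of_nat_Suc)
  qed
  also have "\<dots> = \<rho>"
    unfolding sum_distrib_left[symmetric] sum_inverse_ends using H by simp
  finally show ?thesis .
qed

lemma card_eq_full: "S \<subseteq> {..n::nat} \<Longrightarrow> card S = Suc n \<longleftrightarrow> S = {..n}"
  using card_subset_eq[of "{..n}" S] by auto

lemma card_eq_empty: "S \<subseteq> {..n::nat} \<Longrightarrow> card S = 0 \<longleftrightarrow> S = {}"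
  using finite_subset[of S "{..n}"] by auto

lemma col_weight_marked:
  "(\<Sum>S\<in>Pow {..n}. of_bool (\<not> mixed n S) * col_weight n \<rho> S) = 1 - \<rho>"
proof -
  have "(\<Sum>S\<in>Pow {..n}. of_bool (\<not> mixed n S) * col_weight n \<rho> S)
     = (\<Sum>S\<in>{{}, {..n}}. col_weight n \<rho> S)"
    by (rule sum.mono_neutral_cong_right) (auto simp: mixed_def card_eq_full card_eq_empty)
  also have "\<dots> = 1 - \<rho>" by (subst sum.insert) (auto simp: col_weight_def)
  finally show ?thesis .
qed

lemma sum_col_weight:
  assumes "n \<ge> 1"
  shows "(\<Sum>S\<in>Pow {..n}. col_weight n \<rho> S) = 1"
proof -
  have "(\<Sum>S\<in>Pow {..n}. col_weight n \<rho> S) = (\<Sum>S\<in>Pow {..n}.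
     of_bool (mixed n S) * col_weight n \<rho> S + of_bool (\<not> mixed n S) * col_weight n \<rho> S)"
    by (intro sum.cong) auto
  then show ?thesis by (simp add: sum.distrib col_weight_mixed[OF assms] col_weight_marked)
qed

section \<open>Conditional mean and second moment of the scores\<close>

lemma Suc_times_binomial_diff: "k \<le> n \<Longrightarrow>
  (real (Suc n) - real k) * real (Suc n choose k) = real (Suc n) * real (n choose k)"
proof -
  assume k: "k \<le> n"
  have "(Suc n - k) * (Suc n choose k) = Suc n * (n choose k)"
    using binomial_absorb_comp[of "Suc n" k] by simp
  then have "real (Suc n - k) * real (Suc n choose k) = real (Suc n) * real (n choose k)"
    by (metis of_nat_mult)
  then show ?thesis using k by (simp only: of_nat_diff le_SucI)
qed

text \<open>By the absorption identities for binomials, weight times score depends only on the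
  number k of other users in the column; \<open>weight_score_notin\<close> gives the opposite value
  for the same k. The case k = n is the full column, where \<open>marked_score\<close> is chosen so
  that the formula persists.\<close>

lemma weight_score_in:
  assumes "k \<le> n" "n \<ge> 1" "card S = Suc k" "i \<in> S" "\<rho> < 1"
  shows "col_weight n \<rho> S * col_score n \<rho> i S = \<rho> / (2 * harm n * real (Suc n) * real (n choose k))"
proof -
  have H: "harm n \<noteq> (0::real)" using harm_ge_1[OF assms(2)] by linarith
  show ?thesis
  proof (cases "k = n")
    case True
    then show ?thesis using assms H
      by (simp add: col_weight_def col_score_def marked_score_def divide_simps)
  next
    case False
    have b: "real (Suc k) * real (Suc n choose Suc k) = real (Suc n) * real (n choose k)"
      using Suc_times_binomial_eq[of n k] by (metis mult.commute of_nat_mult)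
    have c: "1 - real (Suc k) / real (Suc n) = (real (Suc n) - real (Suc k)) / real (Suc n)"
      by (simp add: field_simps)
    have nz: "real (Suc n) - real (Suc k) \<noteq> 0" "real (Suc n) \<noteq> 0" using False assms(1) by auto
    have "col_weight n \<rho> S * col_score n \<rho> i S
      = \<rho> * real (Suc n) / (2 * harm n * (real (Suc k) * real (Suc n choose Suc k)) * (real (Suc n) - real (Suc k)))
         * ((real (Suc n) - real (Suc k)) / real (Suc n))"
    proof -
      have w: "col_weight n \<rho> S = \<rho> * real (Suc n) /
         (2 * harm n * real (Suc k) * (real (Suc n) - real (Suc k)) * real (Suc n choose Suc k))"
        using False assms by (simp add: col_weight_def del: binomial_Suc_Suc of_nat_Suc)
      have s: "col_score n \<rho> i S = (real (Suc n) - real (Suc k)) / real (Suc n)"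
        using False assms by (simp add: col_score_def c[symmetric] del: of_nat_Suc)
      show ?thesis unfolding w s by (simp only: mult_ac)
    qed
    also have "\<dots> = \<rho> / (2 * harm n * (real (Suc k) * real (Suc n choose Suc k)))"
    proof -
      have "x * c / (2 * h * b * a) * (a / c) = x / (2 * h * b)" if "a \<noteq> 0" "c \<noteq> 0" for x c h b a :: real
        using that by simp
      from this[OF nz] show ?thesis .
    qed
    finally show ?thesis unfolding b by (simp add: mult_ac)
  qed
qed

lemma weight_score_notin:
  assumes "k \<le> n" "n \<ge> 1" "card S = k" "i \<notin> S" "\<rho> < 1"
  shows "col_weight n \<rho> S * col_score n \<rho> i S = - \<rho> / (2 * harm n * real (Suc n) * real (n choose k))"
proof -
  have H: "harm n \<noteq> (0::real)" using harm_ge_1[OF assms(2)] by linarith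
  show ?thesis
  proof (cases "k = 0")
    case True
    then show ?thesis using assms H
      by (simp add: col_weight_def col_score_def marked_score_def divide_simps)
  next
    case False
    have "col_weight n \<rho> S * col_score n \<rho> i S
      = \<rho> * real (Suc n) / (2 * harm n * real k * ((real (Suc n) - real k) * real (Suc n choose k)))
         * (- (real k / real (Suc n)))"
      using False assms by (simp add: col_weight_def col_score_def mult_ac del: binomial_Suc_Suc of_nat_Suc)
    also have "\<dots> = - \<rho> / (2 * harm n * ((real (Suc n) - real k) * real (Suc n choose k)))"
      using False by (simp del: binomial_Suc_Suc of_nat_Suc)
    finally show ?thesis unfolding Suc_times_binomial_diff[OF assms(1)] by (simp add: mult_ac)
  qed
qed

text \<open>R is what the data set shows of a column, and the two sets are its completions by the
  spare user. Their contributions cancel by the two preceding lemmas with k =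
  \<open>card R\<close>.\<close>

lemma weighted_score_mean_zero:
  assumes "R \<subseteq> {..<n}" "n \<ge> 1" "\<rho> < 1"
  shows "(\<Sum>S\<in>{R, insert n R}. col_weight n \<rho> S * col_score n \<rho> n S) = 0"
proof -
  have "n \<notin> R" "finite R" "card R \<le> n"
    using assms(1) finite_subset[OF assms(1)] card_mono[OF _ assms(1)] by auto
  then show ?thesis using assms
    by (subst sum.insert) (auto simp: weight_score_in[of "card R"] weight_score_notin[of "card R"])
qed

text \<open>In a mixed column the memberships add up to \<open>card S\<close>, exactly the sum of
  the n+1 subtracted averages; in a constant column all n+1 users share the same score.\<close>

lemma sum_col_score:
  assumes "S \<subseteq> {..n}"
  shows "(\<Sum>i\<le>n. col_score n \<rho> i S) = (if mixed n S then 0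
     else (if S = {} then -1 else 1) * real (Suc n) * marked_score n \<rho>)"
proof -
  have "(\<Sum>i\<le>n. of_bool (i \<in> S) :: real) = real (card S)"
    using assms by (simp add: sum.If_cases of_bool_def Int_absorb1 Collect_mem_eq)
  moreover have "finite S" using assms finite_subset by blast
  ultimately show ?thesis using assms
    by (auto simp: col_score_def mixed_def sum_subtractf card_eq_full) (simp add: algebra_simps)
qed

text \<open>The lower bound makes the final exponent large; the upper bound keeps the Chernoff
  parameter below 1 and the second moment of order \<rho>.\<close>

lemma marked_score_bounds:
  assumes "n \<ge> 1" "0 \<le> \<rho>" "\<rho> \<le> 1/2"
  shows "\<rho> / (real (Suc n) * harm n) \<le> marked_score n \<rho>" "marked_score n \<rho> \<le> \<rho>"
proof -
  have H: "harm n \<ge> (1::real)" using harm_ge_1[OF assms(1)] .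
  have N: "real (Suc n) \<ge> 2" using assms(1) by simp
  have "1 \<le> real (Suc n) * harm n" using mult_mono[of 1 "real (Suc n)" 1 "harm n"] N H by simp
  have "1 \<le> real (Suc n) * (1 - \<rho>)" using mult_mono[of 2 "real (Suc n)" "1/2" "1 - \<rho>"] N assms by simp
  then have "1 \<le> real (Suc n) * (1 - \<rho>) * harm n"
     using mult_mono[of 1 "real (Suc n) * (1 - \<rho>)" 1 "harm n"] H by simp
  then show "marked_score n \<rho> \<le> \<rho>" unfolding marked_score_def
     using assms(2) by (simp add: divide_le_eq mult_left_le mult_le_cancel_left1 del: of_nat_Suc)
  show "\<rho> / (real (Suc n) * harm n) \<le> marked_score n \<rho>" unfolding marked_score_def
    using assms H N by (intro divide_left_mono) (auto intro!: mult_right_mono mult_pos_pos simp: mult_left_le)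
qed

lemma abs_col_score_le_1:
  assumes "S \<subseteq> {..n}" "n \<ge> 1" "0 \<le> \<rho>" "\<rho> \<le> 1/2"
  shows "\<bar>col_score n \<rho> i S\<bar> \<le> 1"
proof -
  have "0 \<le> \<rho> / (real (Suc n) * harm n)" using assms by (simp add: harm_nonneg)
  then have "\<bar>marked_score n \<rho>\<bar> \<le> 1" using marked_score_bounds[OF assms(2-4)] assms by linarith
  moreover have "0 \<le> real (card S) / real (Suc n)" "real (card S) / real (Suc n) \<le> 1"
    using card_subset_atMost[OF assms(1)] by (auto simp: divide_le_eq)
  ultimately show ?thesis by (auto simp: col_score_def simp del: of_nat_Suc)
qed

text \<open>Mixed columns have mass \<rho> and scores at most 1 in absolute value; constant columns
  have squared score at most \<rho>. Together this is at most \<rho> + \<rho>(1-\<rho>).\<close>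

lemma col_score_second_moment:
  assumes "n \<ge> 1" "0 \<le> \<rho>" "\<rho> \<le> 1/2"
  shows "(\<Sum>S\<in>Pow {..n}. col_weight n \<rho> S * (col_score n \<rho> i S)\<^sup>2) \<le> 2 * \<rho>"
proof -
  have "0 \<le> \<rho> / (real (Suc n) * harm n)" using assms by (simp add: harm_nonneg)
  then have m: "0 \<le> marked_score n \<rho>" "marked_score n \<rho> \<le> \<rho>" using marked_score_bounds[OF assms] by linarith+
  have "(marked_score n \<rho>)\<^sup>2 \<le> \<rho> * 1" unfolding power2_eq_square using m assms by (intro mult_mono) auto
  then have m2: "(marked_score n \<rho>)\<^sup>2 \<le> \<rho>" by simp
  have "(\<Sum>S\<in>Pow {..n}. col_weight n \<rho> S * (col_score n \<rho> i S)\<^sup>2)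
    \<le> (\<Sum>S\<in>Pow {..n}. of_bool (mixed n S) * col_weight n \<rho> S + \<rho> * (of_bool (\<not> mixed n S) * col_weight n \<rho> S))"
  proof (rule sum_mono)
    fix S assume "S \<in> Pow {..n}"
    then have S: "S \<subseteq> {..n}" by auto
    have w: "0 \<le> col_weight n \<rho> S" using col_weight_nonneg[OF S] assms by auto
    have "(col_score n \<rho> i S)\<^sup>2 \<le> 1" using abs_col_score_le_1[OF S assms] by (simp add: abs_square_le_1)
    moreover have "(col_score n \<rho> i S)\<^sup>2 \<le> \<rho>" if "\<not> mixed n S"
      using that m2 by (auto simp: col_score_def mixed_def)
    ultimately have "(col_score n \<rho> i S)\<^sup>2 \<le> of_bool (mixed n S) + \<rho> * of_bool (\<not> mixed n S)" by auto
    from mult_left_mono[OF this w]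
    show "col_weight n \<rho> S * (col_score n \<rho> i S)\<^sup>2 \<le>
       of_bool (mixed n S) * col_weight n \<rho> S + \<rho> * (of_bool (\<not> mixed n S) * col_weight n \<rho> S)"
      by (simp add: algebra_simps)
  qed
  also have "\<dots> = \<rho> + \<rho> * (1 - \<rho>)"
    unfolding sum.distrib sum_distrib_left[symmetric] col_weight_mixed[OF assms(1)] col_weight_marked ..
  also have "\<dots> \<le> 2 * \<rho>" using assms by (simp add: algebra_simps)
  finally show ?thesis .
qed

section \<open>Concentration over random codebooks\<close>

text \<open>Column j is the set of users, the spare user \<open>n\<close> included, that have +1 in
  coordinate j.\<close>

definition codebooks :: "nat \<Rightarrow> nat \<Rightarrow> (nat \<Rightarrow> nat set) set" where
  "codebooks n d = PiE {..<d} (\<lambda>_. Pow {..n})"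

definition book_weight :: "nat \<Rightarrow> real \<Rightarrow> nat \<Rightarrow> (nat \<Rightarrow> nat set) \<Rightarrow> real" where
  "book_weight n \<rho> d W = (\<Prod>j<d. col_weight n \<rho> (W j))"

definition user_score :: "nat \<Rightarrow> real \<Rightarrow> nat \<Rightarrow> nat set \<Rightarrow> nat \<Rightarrow> (nat \<Rightarrow> nat set) \<Rightarrow> real" where
  "user_score n \<rho> d V i W = (\<Sum>j<d. (if j \<in> V then 1 else -1) * col_score n \<rho> i (W j))"

lemma finite_codebooks: "finite (codebooks n d)"
  unfolding codebooks_def by (intro finite_PiE) auto

lemma codebooks_col: "W \<in> codebooks n d \<Longrightarrow> j < d \<Longrightarrow> W j \<subseteq> {..n}"
  unfolding codebooks_def by (auto dest: PiE_mem)

lemma sum_codebooks_prod: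
  fixes f :: "nat set \<Rightarrow> real"
  shows "(\<Sum>W\<in>codebooks n d. \<Prod>j<d. f (W j)) = (\<Sum>S\<in>Pow {..n}. f S) ^ d"
  unfolding codebooks_def by (subst prod_sum_PiE[symmetric]) auto

lemma book_weight_nonneg:
  assumes "W \<in> codebooks n d" "0 \<le> \<rho>" "\<rho> \<le> 1"
  shows "0 \<le> book_weight n \<rho> d W"
  unfolding book_weight_def using assms codebooks_col[OF assms(1)]
  by (intro prod_nonneg) (auto intro!: col_weight_nonneg)

lemma sum_book_weight: "n \<ge> 1 \<Longrightarrow> (\<Sum>W\<in>codebooks n d. book_weight n \<rho> d W) = 1"
  unfolding book_weight_def by (simp add: sum_codebooks_prod sum_col_weight)

text \<open>This is conditioning on what the data set reveals: a codebook amounts to its restriction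
  R to the users below n together with the spare user's free choice in each column.\<close>

lemma sum_codebooks_split:
  fixes F :: "(nat \<Rightarrow> nat set) \<Rightarrow> real"
  shows "(\<Sum>W\<in>codebooks n d. F W) = (\<Sum>R\<in>PiE {..<d} (\<lambda>_. Pow {..<n}).
     \<Sum>W\<in>PiE {..<d} (\<lambda>j. {R j, insert n (R j)}). F W)"
proof -
  \<comment> \<open>The map \<open>g\<close> erases the spare user from every column; its fibres are
    the inner index sets.\<close>
  define g where "g W = (\<lambda>j\<in>{..<d}. W j - {n})" for W :: "nat \<Rightarrow> nat set"
  have "(\<Sum>W\<in>codebooks n d. F W) = (\<Sum>R\<in>PiE {..<d} (\<lambda>_. Pow {..<n}).
     \<Sum>W\<in>{W\<in>codebooks n d. g W = R}. F W)"
  proof (intro sum.group[symmetric] finite_codebooks finite_PiE)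
    show "g ` codebooks n d \<subseteq> PiE {..<d} (\<lambda>_. Pow {..<n})"
    proof clarify
      fix W assume W: "W \<in> codebooks n d"
      have "W j - {n} \<subseteq> {..<n}" if "j < d" for j
        using codebooks_col[OF W that] by force
      then show "g W \<in> PiE {..<d} (\<lambda>_. Pow {..<n})" by (auto simp: g_def)
    qed
  qed auto
  also have "\<dots> = (\<Sum>R\<in>PiE {..<d} (\<lambda>_. Pow {..<n}).
     \<Sum>W\<in>PiE {..<d} (\<lambda>j. {R j, insert n (R j)}). F W)"
  proof (rule sum.cong[OF refl])
    fix R assume R: "R \<in> PiE {..<d} (\<lambda>_. Pow {..<n})"
    have Rj: "R j \<subseteq> {..<n}" if "j < d" for j using R that by (auto dest: PiE_mem)
    have "{W\<in>codebooks n d. g W = R} = PiE {..<d} (\<lambda>j. {R j, insert n (R j)})"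
    proof (intro equalityI subsetI)
      fix W assume "W \<in> {W\<in>codebooks n d. g W = R}"
      then have W: "W \<in> codebooks n d" "g W = R" by auto
      have "W j = R j \<or> W j = insert n (R j)" if "j < d" for j
        using fun_cong[OF W(2), of j] that by (auto simp: g_def)
      then show "W \<in> PiE {..<d} (\<lambda>j. {R j, insert n (R j)})"
        using W(1) by (auto simp: codebooks_def PiE_iff)
    next
      fix W assume W: "W \<in> PiE {..<d} (\<lambda>j. {R j, insert n (R j)})"
      have Wj: "W j = R j \<or> W j = insert n (R j)" if "j < d" for j
        using W that by (auto simp: PiE_iff)
      have "W j \<subseteq> {..n}" if "j < d" for j using Wj[OF that] Rj[OF that] by force
      moreover have "W j - {n} = R j" if "j < d" for j using Wj[OF that] Rj[OF that] by force
      moreover have "R j = undefined" if "\<not> j < d" for j using R that by (auto simp: PiE_iff extensional_def)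
      ultimately show "W \<in> {W\<in>codebooks n d. g W = R}"
        using W by (auto simp: codebooks_def g_def PiE_iff fun_eq_iff)
    qed
    then show "(\<Sum>W\<in>{W\<in>codebooks n d. g W = R}. F W) = (\<Sum>W\<in>PiE {..<d} (\<lambda>j. {R j, insert n (R j)}). F W)"
      by simp
  qed
  finally show ?thesis .
qed

section \<open>Exponential moments and tail bounds\<close>

lemma exp_le_quadratic: "\<bar>x\<bar> \<le> 1 \<Longrightarrow> exp x \<le> 1 + x + (x::real)\<^sup>2"
proof (cases "x \<ge> 0")
  case True then show "\<bar>x\<bar> \<le> 1 \<Longrightarrow> ?thesis" using exp_bound[of x] by auto
next
  case False
  define u where "u = - x"
  assume "\<bar>x\<bar> \<le> 1"
  then have u: "0 \<le> u" "u \<le> 1" using False by (auto simp: u_def)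
  \<comment> \<open>The product equals 1 + u^3.\<close>
  have "1 \<le> (1 - u + u\<^sup>2) * (1 + u)" using u by (simp add: power2_eq_square algebra_simps)
  also have "\<dots> \<le> (1 - u + u\<^sup>2) * exp u"
    using u by (intro mult_left_mono) (auto simp: exp_ge_add_one_self)
  finally have "exp (-u) \<le> 1 - u + u\<^sup>2" by (simp add: exp_minus field_simps)
  then show ?thesis by (simp add: u_def)
qed

text \<open>After \<open>exp_le_quadratic\<close> the linear term vanishes by the mean-zero
  property, and the square forgets the sign \<sigma>. The bound is therefore the same for every sign
  pattern.\<close>

lemma innocent_column_mgf:
  assumes "R \<subseteq> {..<n}" "n \<ge> 1" "0 \<le> \<rho>" "\<rho> \<le> 1/2" "0 \<le> \<alpha>" "\<alpha> \<le> 1" "\<sigma> = 1 \<or> \<sigma> = -1"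
  shows "(\<Sum>S\<in>{R, insert n R}. col_weight n \<rho> S * exp (\<alpha> * (\<sigma> * col_score n \<rho> n S)))
     \<le> (\<Sum>S\<in>{R, insert n R}. col_weight n \<rho> S * (1 + \<alpha>\<^sup>2 * (col_score n \<rho> n S)\<^sup>2))"
proof -
  have "(\<Sum>S\<in>{R, insert n R}. col_weight n \<rho> S * exp (\<alpha> * (\<sigma> * col_score n \<rho> n S)))
    \<le> (\<Sum>S\<in>{R, insert n R}. col_weight n \<rho> S * (1 + \<alpha>\<^sup>2 * (col_score n \<rho> n S)\<^sup>2)
         + \<alpha> * \<sigma> * (col_weight n \<rho> S * col_score n \<rho> n S))"
  proof (rule sum_mono)
    fix S assume "S \<in> {R, insert n R}"
    then have S: "S \<subseteq> {..n}" using assms(1) by force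
    have w: "0 \<le> col_weight n \<rho> S" using col_weight_nonneg[OF S] assms by auto
    let ?x = "\<alpha> * (\<sigma> * col_score n \<rho> n S)"
    have "\<bar>?x\<bar> \<le> 1" using abs_col_score_le_1[OF S assms(2-4), of n] assms(5-7)
      by (auto simp: abs_mult intro: mult_le_one)
    from exp_le_quadratic[OF this]
    have "exp ?x \<le> 1 + \<alpha>\<^sup>2 * (col_score n \<rho> n S)\<^sup>2 + \<alpha> * \<sigma> * col_score n \<rho> n S"
      using assms(7) by (auto simp: power_mult_distrib)
    from mult_left_mono[OF this w]
    show "col_weight n \<rho> S * exp ?x \<le> col_weight n \<rho> S * (1 + \<alpha>\<^sup>2 * (col_score n \<rho> n S)\<^sup>2)
         + \<alpha> * \<sigma> * (col_weight n \<rho> S * col_score n \<rho> n S)"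
      by (simp add: algebra_simps)
  qed
  also have "\<dots> = (\<Sum>S\<in>{R, insert n R}. col_weight n \<rho> S * (1 + \<alpha>\<^sup>2 * (col_score n \<rho> n S)\<^sup>2))"
    unfolding sum.distrib sum_distrib_left[symmetric]
    using weighted_score_mean_zero[OF assms(1,2), of \<rho>] assms by simp
  finally show ?thesis .
qed

text \<open>The kernel Q ignores the membership of user n. Hence, conditionally on the rest of the codebook,
  the columns of user n are independent with mean-zero scores, whatever the pattern V; summing the
  resulting bound over V removes Q.\<close>

lemma innocent_score_tail:
  fixes Q :: "(nat \<Rightarrow> nat set) \<Rightarrow> nat set \<Rightarrow> real"
  assumes n: "n \<ge> 1" and \<rho>: "0 \<le> \<rho>" "\<rho> \<le> 1/2" and \<alpha>: "0 \<le> \<alpha>" "\<alpha> \<le> 1"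
    and Q_nonneg: "\<And>W V. W \<in> codebooks n d \<Longrightarrow> V \<subseteq> {..<d} \<Longrightarrow> 0 \<le> Q W V"
    and Q_sum: "\<And>W. W \<in> codebooks n d \<Longrightarrow> (\<Sum>V\<in>Pow {..<d}. Q W V) = 1"
    and Q_dep: "\<And>W W'. W \<in> codebooks n d \<Longrightarrow> W' \<in> codebooks n d \<Longrightarrow>
        (\<And>j. j < d \<Longrightarrow> W j - {n} = W' j - {n}) \<Longrightarrow> Q W = Q W'"
  shows "(\<Sum>W\<in>codebooks n d. book_weight n \<rho> d W *
           (\<Sum>V\<in>{V\<in>Pow {..<d}. t \<le> user_score n \<rho> d V n W}. Q W V))
     \<le> exp (2 * \<rho> * \<alpha>\<^sup>2 * real d - \<alpha> * t)"
proof -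
  let ?\<sigma> = "\<lambda>V j. if j \<in> V then 1 else -1 :: real"
  let ?g = "\<lambda>V j S. col_weight n \<rho> S * exp (\<alpha> * (?\<sigma> V j * col_score n \<rho> n S))"
  let ?f = "\<lambda>S. col_weight n \<rho> S * (1 + \<alpha>\<^sup>2 * (col_score n \<rho> n S)\<^sup>2)"
  let ?I = "\<lambda>R. PiE {..<d} (\<lambda>j. {R j, insert n (R j)})"
  let ?B = "PiE {..<d} (\<lambda>_. Pow {..<n})"
  \<comment> \<open>Chernoff's method: the indicator of a score of at least t is bounded by an
    exponential.\<close>
  have "(\<Sum>W\<in>codebooks n d. book_weight n \<rho> d W *
           (\<Sum>V\<in>{V\<in>Pow {..<d}. t \<le> user_score n \<rho> d V n W}. Q W V))
    \<le> (\<Sum>W\<in>codebooks n d. book_weight n \<rho> d W *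
         (\<Sum>V\<in>Pow {..<d}. exp (\<alpha> * (user_score n \<rho> d V n W - t)) * Q W V))"
  proof (intro sum_mono mult_left_mono)
    fix W assume W: "W \<in> codebooks n d"
    show "0 \<le> book_weight n \<rho> d W" using book_weight_nonneg[OF W] \<rho> by auto
    have "(\<Sum>V\<in>{V\<in>Pow {..<d}. t \<le> user_score n \<rho> d V n W}. Q W V)
      \<le> (\<Sum>V\<in>{V\<in>Pow {..<d}. t \<le> user_score n \<rho> d V n W}. exp (\<alpha> * (user_score n \<rho> d V n W - t)) * Q W V)"
    proof (rule sum_mono)
      fix V assume V: "V \<in> {V\<in>Pow {..<d}. t \<le> user_score n \<rho> d V n W}"
      then have "1 \<le> exp (\<alpha> * (user_score n \<rho> d V n W - t))" using \<alpha> by simp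
      from mult_right_mono[OF this, of "Q W V"] V Q_nonneg[OF W]
      show "Q W V \<le> exp (\<alpha> * (user_score n \<rho> d V n W - t)) * Q W V" by simp
    qed
    also have "\<dots> \<le> (\<Sum>V\<in>Pow {..<d}. exp (\<alpha> * (user_score n \<rho> d V n W - t)) * Q W V)"
      using Q_nonneg[OF W] by (intro sum_mono2) auto
    finally show "(\<Sum>V\<in>{V\<in>Pow {..<d}. t \<le> user_score n \<rho> d V n W}. Q W V)
      \<le> (\<Sum>V\<in>Pow {..<d}. exp (\<alpha> * (user_score n \<rho> d V n W - t)) * Q W V)" .
  qed
  also have "\<dots> = exp (- \<alpha> * t) * (\<Sum>W\<in>codebooks n d. \<Sum>V\<in>Pow {..<d}. Q W V * (\<Prod>j<d. ?g V j (W j)))"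
    unfolding sum_distrib_left
  proof (intro sum.cong refl)
    fix W V
    have "exp (\<alpha> * (user_score n \<rho> d V n W - t)) = exp (- \<alpha> * t) * exp (\<alpha> * user_score n \<rho> d V n W)"
      unfolding exp_add[symmetric] by (simp add: algebra_simps)
    also have "exp (\<alpha> * user_score n \<rho> d V n W) = (\<Prod>j<d. exp (\<alpha> * (?\<sigma> V j * col_score n \<rho> n (W j))))"
      unfolding user_score_def sum_distrib_left by (rule exp_sum) simp
    finally show "book_weight n \<rho> d W * (exp (\<alpha> * (user_score n \<rho> d V n W - t)) * Q W V) =
       exp (- \<alpha> * t) * (Q W V * (\<Prod>j<d. ?g V j (W j)))"
      by (simp only: book_weight_def prod.distrib mult_ac)
  qed
  \<comment> \<open>On the fibre over R the kernel is constant. It is evaluated at R itself, the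
    codebook in which the spare user belongs to no column, and the remaining sum of products
    factorises over the columns.\<close>
  also have "(\<Sum>W\<in>codebooks n d. \<Sum>V\<in>Pow {..<d}. Q W V * (\<Prod>j<d. ?g V j (W j)))
     = (\<Sum>R\<in>?B. \<Sum>V\<in>Pow {..<d}. Q R V * (\<Prod>j<d. \<Sum>S\<in>{R j, insert n (R j)}. ?g V j S))"
    unfolding sum_codebooks_split
  proof (rule sum.cong[OF refl])
    fix R assume R: "R \<in> ?B"
    have Rj: "R j \<subseteq> {..<n}" if "j < d" for j using R that by (auto dest: PiE_mem)
    have RC: "R \<in> codebooks n d"
      using R Rj by (force simp: codebooks_def PiE_iff)
    have "Q W = Q R" if W: "W \<in> ?I R" for W
    proof (rule Q_dep[OF _ RC])
      have Wj: "W j = R j \<or> W j = insert n (R j)" if "j < d" for j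
        using W that by (auto simp: PiE_iff)
      have "W j \<subseteq> {..n}" if "j < d" for j using Wj[OF that] Rj[OF that] by force
      then show "W \<in> codebooks n d" using W by (auto simp: codebooks_def PiE_iff)
      show "W j - {n} = R j - {n}" if "j < d" for j using Wj[OF that] Rj[OF that] by force
    qed
    then have "(\<Sum>W\<in>?I R. \<Sum>V\<in>Pow {..<d}. Q W V * (\<Prod>j<d. ?g V j (W j)))
      = (\<Sum>W\<in>?I R. \<Sum>V\<in>Pow {..<d}. Q R V * (\<Prod>j<d. ?g V j (W j)))"
      by (intro sum.cong refl) simp
    also have "\<dots> = (\<Sum>V\<in>Pow {..<d}. Q R V * (\<Sum>W\<in>?I R. \<Prod>j<d. ?g V j (W j)))"
      by (subst sum.swap) (simp only: sum_distrib_left)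
    also have "\<dots> = (\<Sum>V\<in>Pow {..<d}. Q R V * (\<Prod>j<d. \<Sum>S\<in>{R j, insert n (R j)}. ?g V j S))"
      by (subst prod_sum_PiE) auto
    finally show "(\<Sum>W\<in>?I R. \<Sum>V\<in>Pow {..<d}. Q W V * (\<Prod>j<d. ?g V j (W j)))
      = (\<Sum>V\<in>Pow {..<d}. Q R V * (\<Prod>j<d. \<Sum>S\<in>{R j, insert n (R j)}. ?g V j S))" .
  qed
  also have "\<dots> \<le> (\<Sum>R\<in>?B. \<Sum>V\<in>Pow {..<d}. Q R V * (\<Prod>j<d. \<Sum>S\<in>{R j, insert n (R j)}. ?f S))"
  proof (rule sum_mono, rule sum_mono, intro mult_left_mono prod_mono conjI)
    fix R V assume R: "R \<in> ?B" and V: "V \<in> Pow {..<d}"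
    have Rj: "R j \<subseteq> {..<n}" if "j < d" for j using R that by (auto dest: PiE_mem)
    have RC: "R \<in> codebooks n d"
      using R Rj by (force simp: codebooks_def PiE_iff)
    show "0 \<le> Q R V" using Q_nonneg[OF RC] V by auto
    fix j assume j: "j \<in> {..<d}"
    show "(\<Sum>S\<in>{R j, insert n (R j)}. ?g V j S) \<le> (\<Sum>S\<in>{R j, insert n (R j)}. ?f S)"
      using j Rj n \<rho> \<alpha> by (intro innocent_column_mgf) auto
    have "S \<subseteq> {..n}" if "S \<in> {R j, insert n (R j)}" for S
      using that Rj[of j] j by force
    then show "0 \<le> (\<Sum>S\<in>{R j, insert n (R j)}. ?g V j S)"
      using \<rho> by (intro sum_nonneg mult_nonneg_nonneg col_weight_nonneg) auto
  qed
  \<comment> \<open>The product no longer involves V, so the kernel sums to 1.\<close>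
  also have "\<dots> = (\<Sum>R\<in>?B. \<Prod>j<d. \<Sum>S\<in>{R j, insert n (R j)}. ?f S)"
  proof (rule sum.cong[OF refl])
    fix R assume R: "R \<in> ?B"
    have RC: "R \<in> codebooks n d"
      using R by (force simp: codebooks_def PiE_iff)
    show "(\<Sum>V\<in>Pow {..<d}. Q R V * (\<Prod>j<d. \<Sum>S\<in>{R j, insert n (R j)}. ?f S))
       = (\<Prod>j<d. \<Sum>S\<in>{R j, insert n (R j)}. ?f S)"
      unfolding sum_distrib_right[symmetric] Q_sum[OF RC] by simp
  qed
  also have "\<dots> = (\<Sum>W\<in>codebooks n d. \<Prod>j<d. ?f (W j))"
    unfolding sum_codebooks_split by (intro sum.cong refl prod_sum_PiE) auto
  also have "\<dots> = (\<Sum>S\<in>Pow {..n}. ?f S) ^ d" by (rule sum_codebooks_prod)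
  also have "\<dots> \<le> exp (2 * \<rho> * \<alpha>\<^sup>2) ^ d"
  proof (rule power_mono)
    have "(\<Sum>S\<in>Pow {..n}. ?f S) = 1 + \<alpha>\<^sup>2 * (\<Sum>S\<in>Pow {..n}. col_weight n \<rho> S * (col_score n \<rho> n S)\<^sup>2)"
      by (simp add: distrib_left sum.distrib sum_col_weight[OF n] sum_distrib_left mult_ac)
    also have "\<dots> \<le> 1 + \<alpha>\<^sup>2 * (2 * \<rho>)"
      using col_score_second_moment[OF n \<rho>] by (intro add_left_mono mult_left_mono) auto
    also have "\<dots> \<le> exp (2 * \<rho> * \<alpha>\<^sup>2)"
      using exp_ge_add_one_self[of "2 * \<rho> * \<alpha>\<^sup>2"] by (simp add: mult_ac)
    finally show "(\<Sum>S\<in>Pow {..n}. ?f S) \<le> exp (2 * \<rho> * \<alpha>\<^sup>2)" .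
    show "0 \<le> (\<Sum>S\<in>Pow {..n}. ?f S)"
      using \<rho> by (intro sum_nonneg mult_nonneg_nonneg col_weight_nonneg) auto
  qed
  also have "exp (- \<alpha> * t) * exp (2 * \<rho> * \<alpha>\<^sup>2) ^ d = exp (2 * \<rho> * \<alpha>\<^sup>2 * real d - \<alpha> * t)"
    by (simp add: exp_of_nat_mult[symmetric] exp_add[symmetric] algebra_simps)
  finally show ?thesis by (simp add: mult_left_mono)
qed

text \<open>Chernoff bound with parameter 1 for a count with mean \<rho>d: as e - 1 is at most 2,
  the exponential moment is at most exp(2\<rho>d), against the threshold 3\<rho>d.\<close>

lemma many_mixed_tail:
  assumes n: "n \<ge> 1" and \<rho>: "0 \<le> \<rho>" "\<rho> \<le> 1"
  shows "(\<Sum>W\<in>codebooks n d. book_weight n \<rho> d W *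
           of_bool (3 * \<rho> * real d < real (card {j\<in>{..<d}. mixed n (W j)})))
     \<le> exp (- \<rho> * real d)"
proof -
  have "(\<Sum>W\<in>codebooks n d. book_weight n \<rho> d W *
           of_bool (3 * \<rho> * real d < real (card {j\<in>{..<d}. mixed n (W j)})))
    \<le> (\<Sum>W\<in>codebooks n d. book_weight n \<rho> d W *
         (exp (- 3 * \<rho> * real d) * (\<Prod>j<d. exp (of_bool (mixed n (W j))))))"
  proof (intro sum_mono mult_left_mono)
    fix W assume W: "W \<in> codebooks n d"
    show "0 \<le> book_weight n \<rho> d W" using book_weight_nonneg[OF W] \<rho> by auto
    have "(\<Prod>j<d. exp (of_bool (mixed n (W j)) :: real)) = exp (real (card {j\<in>{..<d}. mixed n (W j)}))" (is "?L = _")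
      by (simp add: exp_sum[symmetric] of_bool_def sum.If_cases Int_def)
    then have "exp (- 3 * \<rho> * real d) * ?L = exp (real (card {j\<in>{..<d}. mixed n (W j)}) - 3 * \<rho> * real d)"
      by (simp only: exp_add[symmetric]) simp
    then show "of_bool (3 * \<rho> * real d < real (card {j\<in>{..<d}. mixed n (W j)}))
       \<le> exp (- 3 * \<rho> * real d) * (\<Prod>j<d. exp (of_bool (mixed n (W j)) :: real))"
      by (simp only:) simp
  qed
  also have "\<dots> = exp (- 3 * \<rho> * real d) * (\<Sum>W\<in>codebooks n d. \<Prod>j<d. col_weight n \<rho> (W j) * exp (of_bool (mixed n (W j))))"
    unfolding sum_distrib_left book_weight_def prod.distrib by (simp only: mult_ac)
  also have "\<dots> = exp (- 3 * \<rho> * real d) * (\<Sum>S\<in>Pow {..n}. col_weight n \<rho> S * exp (of_bool (mixed n S))) ^ d"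
    by (subst sum_codebooks_prod) simp
  also have "\<dots> \<le> exp (- 3 * \<rho> * real d) * exp (2 * \<rho>) ^ d"
  proof (intro mult_left_mono power_mono)
    have "(\<Sum>S\<in>Pow {..n}. col_weight n \<rho> S * exp (of_bool (mixed n S)))
      = (\<Sum>S\<in>Pow {..n}. col_weight n \<rho> S + (exp 1 - 1) * (of_bool (mixed n S) * col_weight n \<rho> S))"
      by (intro sum.cong refl) (auto simp: algebra_simps)
    also have "\<dots> = 1 + (exp 1 - 1) * \<rho>"
      unfolding sum.distrib sum_distrib_left[symmetric] by (simp add: sum_col_weight[OF n] col_weight_mixed[OF n])
    also have "\<dots> \<le> 1 + 2 * \<rho>" using exp_le \<rho> by (intro add_left_mono mult_right_mono) auto
    also have "\<dots> \<le> exp (2 * \<rho>)" by (rule exp_ge_add_one_self)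
    finally show "(\<Sum>S\<in>Pow {..n}. col_weight n \<rho> S * exp (of_bool (mixed n S))) \<le> exp (2 * \<rho>)" .
    show "0 \<le> (\<Sum>S\<in>Pow {..n}. col_weight n \<rho> S * exp (of_bool (mixed n S)))"
      using \<rho> by (intro sum_nonneg mult_nonneg_nonneg col_weight_nonneg) auto
  qed auto
  also have "\<dots> = exp (- \<rho> * real d)"
    by (simp add: exp_of_nat_mult[symmetric] exp_add[symmetric] algebra_simps)
  finally show ?thesis .
qed

section \<open>Privacy and accuracy on random codebooks\<close>

text \<open>The spare user \<open>n\<close> has no row, so the data set does not depend on that
  user's memberships.\<close>

definition codebook_data :: "nat \<Rightarrow> nat \<Rightarrow> (nat \<Rightarrow> nat set) \<Rightarrow> nat \<Rightarrow> nat \<Rightarrow> real" where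
  "codebook_data n d W = (\<lambda>i\<in>{..<n}. \<lambda>j\<in>{..<d}. if i \<in> W j then 1 else -1)"

text \<open>Scores depend on an output only through its signs, which reduces the output space to
  finitely many patterns. A coordinate equal to 0 counts as negative.\<close>

definition sign_pattern :: "nat \<Rightarrow> (nat \<Rightarrow> real) \<Rightarrow> nat set" where
  "sign_pattern d y = {j\<in>{..<d}. 0 < y j}"

definition pattern_prob :: "nat \<Rightarrow> (nat \<Rightarrow> real) measure \<Rightarrow> (nat set \<Rightarrow> bool) \<Rightarrow> real" where
  "pattern_prob d B P = measure B {y\<in>space B. P (sign_pattern d y)}"

lemma pattern_sets:
  assumes "sets B = sets (out_space d)"
  shows "{y\<in>space B. P (sign_pattern d y)} \<in> sets B"
proof -
  have sp: "space B = space (out_space d)" using sets_eq_imp_space_eq[OF assms] .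
  have "{y\<in>space B. P (sign_pattern d y)} =
    (\<Union>V\<in>{V\<in>Pow {..<d}. P V}. {y\<in>space (out_space d). \<forall>j\<in>{..<d}. j \<in> V \<longleftrightarrow> 0 < y j})" (is "_ = (\<Union>V\<in>_. ?E V)")
  proof -
    have "y \<in> ?E V \<longleftrightarrow> y \<in> space B \<and> sign_pattern d y = V" if "V \<subseteq> {..<d}" for y V
      using that by (auto simp: sp sign_pattern_def)
    then have "(\<Union>V\<in>{V\<in>Pow {..<d}. P V}. ?E V)
      = (\<Union>V\<in>{V\<in>Pow {..<d}. P V}. {y \<in> space B. sign_pattern d y = V})"
      by (intro SUP_cong refl set_eqI) simp
    also have "\<dots> = {y\<in>space B. P (sign_pattern d y)}"
      by (auto simp: sign_pattern_def)
    finally show ?thesis ..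
  qed
  moreover have "?E V \<in> sets B" for V
    unfolding assms out_space_def by measurable
  ultimately show ?thesis by auto
qed

lemma pattern_prob_sum:
  assumes "prob_space B" "sets B = sets (out_space d)"
  shows "pattern_prob d B P = (\<Sum>V\<in>{V\<in>Pow {..<d}. P V}. pattern_prob d B (\<lambda>V'. V' = V))"
proof -
  interpret prob_space B by fact
  have "{y\<in>space B. P (sign_pattern d y)} = (\<Union>V\<in>{V\<in>Pow {..<d}. P V}. {y\<in>space B. sign_pattern d y = V})"
    by (auto simp: sign_pattern_def)
  moreover have "measure B (\<Union>V\<in>{V\<in>Pow {..<d}. P V}. {y\<in>space B. sign_pattern d y = V})
    = (\<Sum>V\<in>{V\<in>Pow {..<d}. P V}. measure B {y\<in>space B. sign_pattern d y = V})"
  proof (rule finite_measure_finite_Union)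
    show "(\<lambda>V. {y\<in>space B. sign_pattern d y = V}) ` {V\<in>Pow {..<d}. P V} \<subseteq> sets B"
      using pattern_sets[OF assms(2)] by (intro image_subsetI)
  qed (auto simp: disjoint_family_on_def)
  ultimately show ?thesis unfolding pattern_prob_def by (simp only:)
qed

lemma codebook_data_in: "codebook_data n d W \<in> datasets n d"
  by (auto simp: codebook_data_def datasets_def vecs_def)

section \<open>Exchanging a user with the spare user\<close>

definition swap_rows :: "nat \<Rightarrow> nat \<Rightarrow> nat \<Rightarrow> (nat \<Rightarrow> nat set) \<Rightarrow> nat \<Rightarrow> nat set" where
  "swap_rows n d i W = (\<lambda>j\<in>{..<d}. Transposition.transpose i n ` W j)"

lemma swap_rows_in:
  assumes "i \<le> n" "W \<in> codebooks n d"
  shows "swap_rows n d i W \<in> codebooks n d"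
proof -
  have "Transposition.transpose i n k \<le> n" if "k \<le> n" for k using that assms(1) by (auto simp: Transposition.transpose_def)
  then have "Transposition.transpose i n ` W j \<subseteq> {..n}" if "j < d" for j using codebooks_col[OF assms(2) that] by auto
  then show ?thesis by (auto simp: codebooks_def swap_rows_def)
qed

lemma swap_rows_swap_rows:
  assumes "W \<in> codebooks n d"
  shows "swap_rows n d i (swap_rows n d i W) = W"
proof
  fix j
  show "swap_rows n d i (swap_rows n d i W) j = W j"
    using assms by (cases "j < d")
      (simp_all add: swap_rows_def codebooks_def image_image PiE_iff extensional_def)
qed

lemma mem_transpose_image: "k \<in> Transposition.transpose a b ` S \<longleftrightarrow> Transposition.transpose a b k \<in> S"
proof
  assume "Transposition.transpose a b k \<in> S"
  then show "k \<in> Transposition.transpose a b ` S"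
    by (rule rev_image_eqI) simp
qed auto

lemma card_transpose_image: "card (Transposition.transpose i n ` S) = card S"
  by (intro card_image inj_on_inverseI[where g = "Transposition.transpose i n"]) simp

lemma book_weight_swap_rows: "book_weight n \<rho> d (swap_rows n d i W) = book_weight n \<rho> d W"
  unfolding book_weight_def
  by (intro prod.cong refl) (simp add: swap_rows_def col_weight_def card_transpose_image)

text \<open>A column score depends on the set only through its size and the membership of the scored
  user, and the transposition keeps the first and exchanges the second.\<close>

lemma user_score_swap_rows: "user_score n \<rho> d V n (swap_rows n d i W) = user_score n \<rho> d V i W"
  unfolding user_score_def
  by (intro sum.cong refl)
     (simp add: swap_rows_def col_score_def card_transpose_image mem_transpose_image)

lemma codebook_data_swap_rows:
  assumes "k < n" "k \<noteq> i"
  shows "codebook_data n d (swap_rows n d i W) k = codebook_data n d W k"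
proof -
  have "k \<in> Transposition.transpose i n ` S \<longleftrightarrow> k \<in> S" for S
    using assms by (simp add: mem_transpose_image)
  then show ?thesis using assms by (auto simp: codebook_data_def swap_rows_def fun_eq_iff)
qed

lemma diff_private_swap_rows:
  assumes dp: "diff_private n d \<epsilon> \<delta> A" and "0 \<le> \<delta>" "0 \<le> \<epsilon>" and i: "i < n"
  shows "pattern_prob d (A (codebook_data n d W)) P
    \<le> exp \<epsilon> * pattern_prob d (A (codebook_data n d (swap_rows n d i W))) P + \<delta>"
proof -
  let ?X = "codebook_data n d W" and ?X' = "codebook_data n d (swap_rows n d i W)"
  let ?T = "{y\<in>space (out_space d). P (sign_pattern d y)}"
  have sets: "sets (A X) = sets (out_space d)" if "X \<in> datasets n d" for X
    using dp that by (auto simp: diff_private_def is_mechanism_def)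
  have pp: "pattern_prob d (A X) P = measure (A X) ?T" if "X \<in> datasets n d" for X
    unfolding pattern_prob_def using sets_eq_imp_space_eq[OF sets[OF that]] by simp
  have "measure (A ?X) ?T \<le> exp \<epsilon> * measure (A ?X') ?T + \<delta>"
  proof (cases "?X i = ?X' i")
    \<comment> \<open>\<open>neighbors\<close> requires row i to differ, so coinciding data sets are
      treated separately; there the inequality is immediate from \<epsilon> and \<delta> being
      nonnegative.\<close>
    case True
    have "?X k = ?X' k" for k
    proof (cases "k < n \<and> k \<noteq> i")
      case False
      then show ?thesis using True i by (cases "k = i") (auto simp: codebook_data_def)
    qed (simp add: codebook_data_swap_rows)
    then have eq: "?X = ?X'" by auto
    have "measure (A ?X) ?T \<le> exp \<epsilon> * measure (A ?X) ?T"
      using mult_right_mono[of 1 "exp \<epsilon>" "measure (A ?X) ?T"] assms(3) by simp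
    then show ?thesis using assms(2) eq by simp
  next
    case False
    then have "neighbors n d ?X ?X'"
      unfolding neighbors_def using i by (auto simp: codebook_data_in codebook_data_swap_rows intro!: exI[of _ i])
    moreover have "?T \<in> sets (out_space d)" by (rule pattern_sets) simp
    ultimately show ?thesis using dp unfolding diff_private_def by blast
  qed
  then show ?thesis by (simp add: pp codebook_data_in)
qed

text \<open>Privacy replaces the data of W by those of the swapped codebook, in which the score of
  user i on W has become the score of the spare user.\<close>

lemma accusation_bound:
  assumes dp: "diff_private n d 1 \<delta> A" and "0 \<le> \<delta>" and n: "n \<ge> 1" and \<rho>: "0 \<le> \<rho>" "\<rho> \<le> 1" and i: "i < n"
  shows "(\<Sum>W\<in>codebooks n d. book_weight n \<rho> d W *
        pattern_prob d (A (codebook_data n d W)) (\<lambda>V. t \<le> user_score n \<rho> d V i W))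
    \<le> exp 1 * (\<Sum>W\<in>codebooks n d. book_weight n \<rho> d W *
        pattern_prob d (A (codebook_data n d W)) (\<lambda>V. t \<le> user_score n \<rho> d V n W)) + \<delta>"
proof -
  let ?s = "swap_rows n d i"
  let ?F = "\<lambda>W. pattern_prob d (A (codebook_data n d W)) (\<lambda>V. t \<le> user_score n \<rho> d V n W)"
  have "(\<Sum>W\<in>codebooks n d. book_weight n \<rho> d W *
        pattern_prob d (A (codebook_data n d W)) (\<lambda>V. t \<le> user_score n \<rho> d V i W))
    \<le> (\<Sum>W\<in>codebooks n d. book_weight n \<rho> d W * (exp 1 * ?F (?s W) + \<delta>))"
  proof (intro sum_mono mult_left_mono)
    fix W assume W: "W \<in> codebooks n d"
    show "0 \<le> book_weight n \<rho> d W" using book_weight_nonneg[OF W \<rho>] .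
    show "pattern_prob d (A (codebook_data n d W)) (\<lambda>V. t \<le> user_score n \<rho> d V i W) \<le> exp 1 * ?F (?s W) + \<delta>"
      unfolding user_score_swap_rows using diff_private_swap_rows[OF dp assms(2) _ i] by simp
  qed
  also have "\<dots> = exp 1 * (\<Sum>W\<in>codebooks n d. book_weight n \<rho> d (?s W) * ?F (?s W))
      + (\<Sum>W\<in>codebooks n d. book_weight n \<rho> d W) * \<delta>"
    by (simp add: book_weight_swap_rows distrib_left sum.distrib sum_distrib_left sum_distrib_right mult_ac)
  \<comment> \<open>The exchange is an involution of the codebooks, so the sum is merely
    reindexed.\<close>
  also have "(\<Sum>W\<in>codebooks n d. book_weight n \<rho> d (?s W) * ?F (?s W))
     = (\<Sum>W\<in>codebooks n d. book_weight n \<rho> d W * ?F W)"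
    using i by (intro sum.reindex_bij_witness[of _ ?s ?s]) (auto simp: swap_rows_in swap_rows_swap_rows)
  finally show ?thesis by (simp add: sum_book_weight[OF n])
qed

section \<open>Accuracy forces a high score\<close>

text \<open>Rows agree in constant columns, and a difference of two signs has square at most
  4.\<close>

lemma edist_codebook_data:
  assumes W: "W \<in> codebooks n d" and "i < n" "k < n"
  shows "(edist d (codebook_data n d W i) (codebook_data n d W k))\<^sup>2
    \<le> 4 * real (card {j\<in>{..<d}. mixed n (W j)})"
proof -
  let ?X = "codebook_data n d W"
  have "(edist d (?X i) (?X k))\<^sup>2 = (\<Sum>j<d. (?X i j - ?X k j)\<^sup>2)"
    unfolding edist_def by (simp add: sum_nonneg)
  also have "\<dots> \<le> (\<Sum>j<d. 4 * of_bool (mixed n (W j)))"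
  proof (rule sum_mono)
    fix j assume "j \<in> {..<d}"
    then have j: "j < d" by simp
    have "mixed n (W j) \<or> W j = {} \<or> W j = {..n}"
      using codebooks_col[OF W j] by (auto simp: mixed_def card_eq_full card_eq_empty)
    then have "?X i j = ?X k j" if "\<not> mixed n (W j)"
      using that assms(2,3) j unfolding codebook_data_def by (elim disjE) simp_all
    moreover have "(?X i j - ?X k j)\<^sup>2 \<le> 4"
      using assms(2,3) j by (simp add: codebook_data_def)
    ultimately show "(?X i j - ?X k j)\<^sup>2 \<le> 4 * of_bool (mixed n (W j))"
      by (cases "mixed n (W j)") simp_all
  qed
  also have "\<dots> = 4 * real (card {j\<in>{..<d}. mixed n (W j)})"
    by (simp add: sum_distrib_left[symmetric] of_bool_def sum.If_cases Int_def)
  finally show ?thesis .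
qed

text \<open>The scores of all n+1 users are added up. Mixed columns contribute 0, and constant
  columns contribute (n+1)h or -(n+1)h according to whether the output has the right sign. Accuracy
  makes wrong signs rare, so the average score, and hence some score, is at least hd/2.\<close>

lemma accurate_pattern_accuses:
  assumes W: "W \<in> codebooks n d" and n: "n \<ge> 1" and h: "0 \<le> marked_score n \<rho>"
    and mix: "real (card {j\<in>{..<d}. mixed n (W j)}) \<le> real d / 40"
    and acc: "(edist d y (avg n d (codebook_data n d W)))\<^sup>2 \<le> real d / 10"
  shows "\<exists>i\<le>n. marked_score n \<rho> * real d / 2 \<le> user_score n \<rho> d (sign_pattern d y) i W"
proof (rule ccontr)
  assume "\<not> ?thesis"
  then have less: "user_score n \<rho> d (sign_pattern d y) i W < marked_score n \<rho> * real d / 2" if "i \<le> n" for i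
    using that by force
  let ?a = "avg n d (codebook_data n d W)" and ?N = "real (Suc n) * marked_score n \<rho>"
  \<comment> \<open>The budget is 1 - 1/40 - 2/10 = 31/40, which exceeds the required 1/2.\<close>
  have "?N * (real d - real d / 40 - 2 * (real d / 10))
    \<le> ?N * (real d - real (card {j\<in>{..<d}. mixed n (W j)}) - 2 * (edist d y ?a)\<^sup>2)"
    using mix acc h by (intro mult_left_mono) auto
  also have "(edist d y ?a)\<^sup>2 = (\<Sum>j<d. (y j - ?a j)\<^sup>2)"
    unfolding edist_def by (simp add: sum_nonneg)
  also have "real (card {j\<in>{..<d}. mixed n (W j)}) = (\<Sum>j<d. of_bool (mixed n (W j)))"
    by (simp add: of_bool_def sum.If_cases Int_def)
  also have "?N * (real d - (\<Sum>j<d. of_bool (mixed n (W j))) - 2 * (\<Sum>j<d. (y j - ?a j)\<^sup>2))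
    = (\<Sum>j<d. ?N * (1 - of_bool (mixed n (W j)) - 2 * (y j - ?a j)\<^sup>2))"
    by (simp add: sum_distrib_left[symmetric] sum_subtractf)
  \<comment> \<open>Columnwise: a wrong sign in a constant column costs a squared error of at least
    1, so 1 minus twice that error is at most -1; with the right sign the value is at most
    1.\<close>
  also have "\<dots> \<le> (\<Sum>j<d. (if j \<in> sign_pattern d y then 1 else -1) * (\<Sum>i\<le>n. col_score n \<rho> i (W j)))"
  proof (rule sum_mono)
    fix j assume "j \<in> {..<d}"
    then have j: "j < d" by simp
    have N: "0 \<le> ?N" using h by simp
    have Wj: "W j \<subseteq> {..n}" using codebooks_col[OF W j] .
    consider "mixed n (W j)" | "\<not> mixed n (W j)" "W j = {}" | "\<not> mixed n (W j)" "W j = {..n}"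
      using Wj by (auto simp: mixed_def card_eq_full card_eq_empty)
    then show "?N * (1 - of_bool (mixed n (W j)) - 2 * (y j - ?a j)\<^sup>2)
      \<le> (if j \<in> sign_pattern d y then 1 else -1) * (\<Sum>i\<le>n. col_score n \<rho> i (W j))"
    proof cases
      case 1
      then show ?thesis using N by (simp add: sum_col_score[OF Wj] mult_nonneg_nonpos del: of_nat_Suc)
    next
      case 2
      then have a: "?a j = -1" using j n by (simp add: avg_def codebook_data_def)
      have s: "(\<Sum>i\<le>n. col_score n \<rho> i (W j)) = - ?N"
        unfolding sum_col_score[OF Wj] using 2 by (simp del: of_nat_Suc)
      have eq: "(if j \<in> sign_pattern d y then 1 else -1) * (\<Sum>i\<le>n. col_score n \<rho> i (W j))
        = ?N * (if j \<in> sign_pattern d y then -1 else 1)"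
        unfolding s by simp
      have "1 - of_bool (mixed n (W j)) - 2 * (y j - ?a j)\<^sup>2 \<le> (if j \<in> sign_pattern d y then -1 else 1)"
        using 2 j one_le_power[of "y j + 1" 2] by (auto simp: a sign_pattern_def)
      from mult_left_mono[OF this N] show ?thesis unfolding eq .
    next
      case 3
      then have a: "?a j = 1" using j n by (simp add: avg_def codebook_data_def)
      have s: "(\<Sum>i\<le>n. col_score n \<rho> i (W j)) = ?N"
        unfolding sum_col_score[OF Wj] using 3 by (simp del: of_nat_Suc)
      have eq: "(if j \<in> sign_pattern d y then 1 else -1) * (\<Sum>i\<le>n. col_score n \<rho> i (W j))
        = ?N * (if j \<in> sign_pattern d y then 1 else -1)"
        unfolding s by simp
      have "1 - of_bool (mixed n (W j)) - 2 * (y j - ?a j)\<^sup>2 \<le> (if j \<in> sign_pattern d y then 1 else -1)"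
        using 3 j one_le_power[of "1 - y j" 2] by (auto simp: a sign_pattern_def power2_commute)
      from mult_left_mono[OF this N] show ?thesis unfolding eq .
    qed
  qed
  also have "\<dots> = (\<Sum>i\<le>n. user_score n \<rho> d (sign_pattern d y) i W)"
    unfolding user_score_def sum_distrib_left by (rule sum.swap)
  also have "\<dots> < (\<Sum>i\<le>n. marked_score n \<rho> * real d / 2)"
    using less by (intro sum_strict_mono) auto
  also have "\<dots> = ?N * (real d / 2)" by simp
  finally have "?N * (real d - real d / 40 - 2 * (real d / 10)) < ?N * (real d / 2)" .
  moreover have "?N * (real d / 2) \<le> ?N * (real d - real d / 40 - 2 * (real d / 10))"
    using h by (intro mult_left_mono) auto
  ultimately show False by simp
qed

text \<open>With few mixed columns the rows lie within \<gamma> of each other, so the estimator's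
  guarantee applies, and every accurate output gives some user a score above the threshold.\<close>

lemma codebook_accuracy:
  assumes W: "W \<in> codebooks n d" and n: "n \<ge> 1"
    and est: "averaging_estimator n d lam \<beta> M" and mech: "is_mechanism n d (M \<gamma>)"
    and lam: "1 \<le> lam" and \<rho>: "0 \<le> \<rho>" "120 * \<rho> * lam\<^sup>2 \<le> 1" and \<gamma>: "\<gamma> = sqrt (12 * \<rho> * real d)"
    and h: "0 \<le> marked_score n \<rho>"
    and mix: "real (card {j\<in>{..<d}. mixed n (W j)}) \<le> 3 * \<rho> * real d"
  shows "\<beta> \<le> pattern_prob d (M \<gamma> (codebook_data n d W))
    (\<lambda>V. \<exists>i\<le>n. marked_score n \<rho> * real d / 2 \<le> user_score n \<rho> d V i W)"
proof -
  let ?X = "codebook_data n d W"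
  let ?B = "M \<gamma> ?X"
  interpret prob_space ?B using mech codebook_data_in by (auto simp: is_mechanism_def)
  have sets: "sets ?B = sets (out_space d)" using mech codebook_data_in by (auto simp: is_mechanism_def)
  have g0: "0 \<le> \<gamma>" and g2: "\<gamma>\<^sup>2 = 12 * \<rho> * real d" using \<gamma> \<rho> by auto
  have close: "edist d (?X i) (?X k) \<le> \<gamma>" if "i < n" "k < n" for i k
  proof (rule power2_le_imp_le[OF _ g0])
    \<comment> \<open>The squared distance is at most 4 times the number of mixed columns, which is
      why the constant in \<gamma> is 12 = 4 * 3.\<close>
    show "(edist d (?X i) (?X k))\<^sup>2 \<le> \<gamma>\<^sup>2"
      using edist_codebook_data[OF W that] mix g2 by linarith
  qed
  have "\<forall>i<n. \<forall>j<d. ?X i j \<in> {-1, 1}" by (simp add: codebook_data_def)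
  then have "\<beta> \<le> measure ?B {y \<in> space ?B. edist d y (avg n d ?X) \<le> lam * \<gamma>}"
    using est g0 close codebook_data_in[of n d W] unfolding averaging_estimator_def by blast
  also have "\<dots> \<le> measure ?B {y \<in> space ?B. \<exists>i\<le>n. marked_score n \<rho> * real d / 2 \<le> user_score n \<rho> d (sign_pattern d y) i W}"
  proof (rule finite_measure_mono)
    show "{y \<in> space ?B. \<exists>i\<le>n. marked_score n \<rho> * real d / 2 \<le> user_score n \<rho> d (sign_pattern d y) i W} \<in> sets ?B"
      using pattern_sets[OF sets, where P="\<lambda>V. \<exists>i\<le>n. marked_score n \<rho> * real d / 2 \<le> user_score n \<rho> d V i W"] .
    have "\<exists>i\<le>n. marked_score n \<rho> * real d / 2 \<le> user_score n \<rho> d (sign_pattern d y) i W"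
      if "edist d y (avg n d ?X) \<le> lam * \<gamma>" for y
    proof (rule accurate_pattern_accuses[OF W n h])
      have "0 \<le> edist d y (avg n d ?X)" by (simp add: edist_def sum_nonneg)
      then have "(edist d y (avg n d ?X))\<^sup>2 \<le> (lam * \<gamma>)\<^sup>2" using that by (intro power_mono)
      also have "\<dots> = (120 * \<rho> * lam\<^sup>2) * (real d / 10)" by (simp add: power_mult_distrib g2)
      also have "\<dots> \<le> 1 * (real d / 10)" using \<rho> by (intro mult_right_mono) auto
      finally show "(edist d y (avg n d ?X))\<^sup>2 \<le> real d / 10" by simp
      have "120 * \<rho> * 1 \<le> 120 * \<rho> * lam\<^sup>2" using \<rho>(1) lam by (intro mult_left_mono) auto
      then have "3 * \<rho> \<le> 1 / 40" using \<rho>(2) by linarith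
      then have "3 * \<rho> * real d \<le> 1 / 40 * real d" by (intro mult_right_mono) auto
      then show "real (card {j\<in>{..<d}. mixed n (W j)}) \<le> real d / 40" using mix by simp
    qed
    then show "{y \<in> space ?B. edist d y (avg n d ?X) \<le> lam * \<gamma>} \<subseteq>
      {y \<in> space ?B. \<exists>i\<le>n. marked_score n \<rho> * real d / 2 \<le> user_score n \<rho> d (sign_pattern d y) i W}" by auto
  qed
  finally show ?thesis by (simp add: pattern_prob_def)
qed

section \<open>Combining accuracy, privacy and concentration\<close>

text \<open>A union bound over the n+1 users: the spare user contributes one exponential tail, each
  other user at most e < 3 times that tail plus \<delta>, and the last term pays for codebooks with
  too many mixed columns.\<close>

lemma fingerprinting_bound:
  assumes n: "n \<ge> 1" and lam: "1 \<le> lam" and \<beta>: "\<beta> \<le> 1"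
    and est: "averaging_estimator n d lam \<beta> M"
    and dp: "\<And>\<gamma>. \<gamma> \<ge> 0 \<Longrightarrow> diff_private n d 1 \<delta> (M \<gamma>)" and \<delta>: "0 \<le> \<delta>"
    and \<rho>: "0 < \<rho>" "120 * \<rho> * lam\<^sup>2 \<le> 1"
  shows "\<beta> \<le> (3 * real n + 1) * exp (- ((marked_score n \<rho>)\<^sup>2 * real d / (32 * \<rho>))) + real n * \<delta>
     + exp (- \<rho> * real d)"
proof -
  define h where "h = marked_score n \<rho>"
  define \<gamma> where "\<gamma> = sqrt (12 * \<rho> * real d)"
  define t where "t = h * real d / 2"
  define P where "P i W = pattern_prob d (M \<gamma> (codebook_data n d W)) (\<lambda>V. t \<le> user_score n \<rho> d V i W)" for i W
  define Acc where "Acc i = (\<Sum>W\<in>codebooks n d. book_weight n \<rho> d W * P i W)" for i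
  have "120 * \<rho> * 1 \<le> 120 * \<rho> * lam\<^sup>2" using \<rho>(1) lam by (intro mult_left_mono) auto
  then have \<rho>2: "0 \<le> \<rho>" "\<rho> \<le> 1/2" using \<rho> by linarith+
  have "0 \<le> \<rho> / (real (Suc n) * harm n)" using \<rho> by (simp add: harm_nonneg)
  then have h: "0 \<le> h" "h \<le> \<rho>" unfolding h_def using marked_score_bounds[OF n \<rho>2] by linarith+
  have dp': "diff_private n d 1 \<delta> (M \<gamma>)" using dp \<rho>2 by (simp add: \<gamma>_def)
  then have mech: "is_mechanism n d (M \<gamma>)" by (simp add: diff_private_def)
  have prob: "prob_space (M \<gamma> (codebook_data n d W))" "sets (M \<gamma> (codebook_data n d W)) = sets (out_space d)" for W
    using mech codebook_data_in[of n d W] by (auto simp: is_mechanism_def)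

  have "Acc n \<le> exp (2 * \<rho> * (h / (8 * \<rho>))\<^sup>2 * real d - (h / (8 * \<rho>)) * t)"
  proof -
    let ?Q = "\<lambda>W V. pattern_prob d (M \<gamma> (codebook_data n d W)) (\<lambda>V'. V' = V)"
    have "Acc n = (\<Sum>W\<in>codebooks n d. book_weight n \<rho> d W *
           (\<Sum>V\<in>{V\<in>Pow {..<d}. t \<le> user_score n \<rho> d V n W}. ?Q W V))"
      unfolding Acc_def P_def by (intro sum.cong refl arg_cong2[where f="(*)"] pattern_prob_sum prob)
    also have "\<dots> \<le> exp (2 * \<rho> * (h / (8 * \<rho>))\<^sup>2 * real d - (h / (8 * \<rho>)) * t)"
    proof (rule innocent_score_tail[OF n \<rho>2])
      show "0 \<le> h / (8 * \<rho>)" "h / (8 * \<rho>) \<le> 1" using h \<rho> by auto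
      show "0 \<le> ?Q W V" for W V by (simp add: pattern_prob_def)
      show "(\<Sum>V\<in>Pow {..<d}. ?Q W V) = 1" for W
        using pattern_prob_sum[OF prob(1)[of W] prob(2)[of W], where P = "\<lambda>_. True"] prob_space.prob_space[OF prob(1)[of W]]
        by (simp add: pattern_prob_def Pow_def)
      show "?Q W = ?Q W'" if "\<And>j. j < d \<Longrightarrow> W j - {n} = W' j - {n}" for W W'
      proof -
        have "i \<in> W j \<longleftrightarrow> i \<in> W' j" if "i < n" "j < d" for i j
          using \<open>\<And>j. j < d \<Longrightarrow> W j - {n} = W' j - {n}\<close>[OF that(2)] that(1) by blast
        then have "codebook_data n d W = codebook_data n d W'"
          by (auto simp: codebook_data_def fun_eq_iff)
        then show ?thesis by simp
      qed
    qed
    finally show ?thesis .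
  qed
  \<comment> \<open>The value h / (8 \<rho>) minimises the exponent.\<close>
  also have "2 * \<rho> * (h / (8 * \<rho>))\<^sup>2 * real d - (h / (8 * \<rho>)) * t = - (h\<^sup>2 * real d / (32 * \<rho>))"
    using \<rho> by (simp add: t_def field_simps power2_eq_square)
  finally have Accn: "Acc n \<le> exp (- (h\<^sup>2 * real d / (32 * \<rho>)))" .
  have Acc0: "0 \<le> Acc n" unfolding Acc_def P_def pattern_prob_def
    using \<rho>2 by (intro sum_nonneg mult_nonneg_nonneg book_weight_nonneg) auto

  have "\<beta> = (\<Sum>W\<in>codebooks n d. book_weight n \<rho> d W * \<beta>)"
    by (simp add: sum_distrib_right[symmetric] sum_book_weight[OF n])
  \<comment> \<open>On codebooks with too many mixed columns the indicator alone is 1, hence at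
    least \<beta>; on the others accuracy and the union bound apply.\<close>
  also have "\<dots> \<le> (\<Sum>W\<in>codebooks n d. book_weight n \<rho> d W * ((\<Sum>i\<le>n. P i W)
      + of_bool (3 * \<rho> * real d < real (card {j\<in>{..<d}. mixed n (W j)}))))"
  proof (intro sum_mono mult_left_mono)
    fix W assume W: "W \<in> codebooks n d"
    show "0 \<le> book_weight n \<rho> d W" using book_weight_nonneg[OF W] \<rho>2 by auto
    interpret prob_space "M \<gamma> (codebook_data n d W)" by (rule prob)
    let ?B = "M \<gamma> (codebook_data n d W)"
    have P0: "0 \<le> (\<Sum>i\<le>n. P i W)" unfolding P_def pattern_prob_def by (intro sum_nonneg) auto
    show "\<beta> \<le> (\<Sum>i\<le>n. P i W) + of_bool (3 * \<rho> * real d < real (card {j\<in>{..<d}. mixed n (W j)}))"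
    proof (cases "3 * \<rho> * real d < real (card {j\<in>{..<d}. mixed n (W j)})")
      case True
      then show ?thesis using P0 \<beta> by simp
    next
      case False
      have "\<beta> \<le> pattern_prob d ?B (\<lambda>V. \<exists>i\<le>n. t \<le> user_score n \<rho> d V i W)"
        unfolding t_def h_def using False h
        by (intro codebook_accuracy[OF W n est mech lam \<rho>2(1) \<rho>(2) \<gamma>_def]) (auto simp: h_def)
      also have "\<dots> = measure ?B (\<Union>i\<le>n. {y\<in>space ?B. t \<le> user_score n \<rho> d (sign_pattern d y) i W})"
        unfolding pattern_prob_def by (intro arg_cong[where f="measure ?B"]) auto
      also have "\<dots> \<le> (\<Sum>i\<le>n. P i W)"
        unfolding P_def pattern_prob_def
      proof (rule finite_measure_subadditive_finite)
        show "(\<lambda>i. {y\<in>space ?B. t \<le> user_score n \<rho> d (sign_pattern d y) i W}) ` {..n} \<subseteq> sets ?B"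
        proof (rule image_subsetI)
          fix i
          show "{y\<in>space ?B. t \<le> user_score n \<rho> d (sign_pattern d y) i W} \<in> sets ?B"
            using pattern_sets[OF prob(2), where P="\<lambda>V. t \<le> user_score n \<rho> d V i W"] .
        qed
      qed simp
      finally show ?thesis using False by simp
    qed
  qed
  also have "\<dots> = (\<Sum>i\<le>n. Acc i) + (\<Sum>W\<in>codebooks n d. book_weight n \<rho> d W *
      of_bool (3 * \<rho> * real d < real (card {j\<in>{..<d}. mixed n (W j)})))"
  proof -
    have "(\<Sum>i\<le>n. Acc i) = (\<Sum>W\<in>codebooks n d. book_weight n \<rho> d W * (\<Sum>i\<le>n. P i W))"
      unfolding Acc_def sum_distrib_left by (rule sum.swap)
    then show ?thesis by (simp only: distrib_left sum.distrib)
  qed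
  also have "\<dots> \<le> (\<Sum>i\<le>n. Acc i) + exp (- \<rho> * real d)"
    using many_mixed_tail[OF n, of \<rho> d] \<rho>2 by (intro add_left_mono) auto
  also have "(\<Sum>i\<le>n. Acc i) = (\<Sum>i<n. Acc i) + Acc n"
    by (simp add: lessThan_Suc_atMost[symmetric])
  also have "(\<Sum>i<n. Acc i) \<le> (\<Sum>i<n. 3 * Acc n + \<delta>)"
  proof (rule sum_mono)
    fix i assume "i \<in> {..<n}"
    then have "Acc i \<le> exp 1 * Acc n + \<delta>"
      unfolding Acc_def P_def using \<rho>2 by (intro accusation_bound[OF dp' \<delta> n]) auto
    also have "\<dots> \<le> 3 * Acc n + \<delta>" using exp_le Acc0 by (intro add_right_mono mult_right_mono) auto
    finally show "Acc i \<le> 3 * Acc n + \<delta>" .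
  qed
  also have "(\<Sum>i<n. 3 * Acc n + \<delta>) + Acc n = (3 * real n + 1) * Acc n + real n * \<delta>"
    by (simp add: algebra_simps)
  also have "\<dots> \<le> (3 * real n + 1) * exp (- (h\<^sup>2 * real d / (32 * \<rho>))) + real n * \<delta>"
    using Accn by (intro add_right_mono mult_left_mono) auto
  finally show ?thesis unfolding h_def by simp
qed

text \<open>The sequence \<open>harm n - ln n\<close> decreases from its value 1 at n = 1.\<close>

lemma harm_le_1_ln:
  assumes "n \<ge> 1"
  shows "harm n \<le> 1 + ln (real n)"
  using decseqD[OF decseq_harm_diff_ln, of 0 "n - 1"] assms by (simp add: harm_def)

section \<open>The lower bound\<close>

theorem theorem1p9:
  shows "\<exists>c>0. \<forall>(n::nat) (d::nat) (lam::real) (\<beta>::real)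
            (M :: real \<Rightarrow> (nat \<Rightarrow> nat \<Rightarrow> real) \<Rightarrow> (nat \<Rightarrow> real) measure).
     n \<ge> 1 \<longrightarrow> lam \<ge> 1 \<longrightarrow> 0 < \<beta> \<longrightarrow> \<beta> \<le> 1 \<longrightarrow>
     averaging_estimator n d lam \<beta> M \<longrightarrow>
     (\<forall>\<gamma>\<ge>0. diff_private n d 1 (\<beta> / (4 * real n)) (M \<gamma>)) \<longrightarrow>
     real n \<ge> c * ((sqrt (real d) / lam) /
                     (ln (max (exp 1) (real d / (\<beta> * lam)))) powr (3/2))"
\<comment> \<open>The constant works because 250^2 = 62500 is at least 120 * 32 * 2^2 * 2^2 = 61440,
  the factor arising from \<rho>, the tail exponent, n+1 \<le> 2n and H \<le> 2L.\<close>
proof (intro exI[of _ "1/250"] conjI allI impI)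
  fix n d :: nat and lam \<beta> :: real
    and M :: "real \<Rightarrow> (nat \<Rightarrow> nat \<Rightarrow> real) \<Rightarrow> (nat \<Rightarrow> real) measure"
  assume n: "n \<ge> 1" and lam: "lam \<ge> 1" and \<beta>: "0 < \<beta>" "\<beta> \<le> 1"
    and est: "averaging_estimator n d lam \<beta> M"
    and dp: "\<forall>\<gamma>\<ge>0. diff_private n d 1 (\<beta> / (4 * real n)) (M \<gamma>)"
  define L where "L = ln (max (exp 1) (real d / (\<beta> * lam)))"
  define H where "H = (harm n :: real)"
  \<comment> \<open>The largest \<rho> that the accuracy condition
    \<open>120 * \<rho> * lam\<^sup>2 \<le> 1\<close> permits.\<close>
  define \<rho> where "\<rho> = 1 / (120 * lam\<^sup>2)"
  have max: "exp 1 \<le> max (exp 1) (real d / (\<beta> * lam))" "real d / (\<beta> * lam) \<le> max (exp 1) (real d / (\<beta> * lam))"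
    by auto
  have expL: "exp L = max (exp 1) (real d / (\<beta> * lam))"
    unfolding L_def by (rule exp_ln) (rule less_le_trans[OF exp_gt_zero max(1)])
  have L1: "1 \<le> L" using max(1) unfolding expL[symmetric] by simp
  show "1/250 * ((sqrt (real d) / lam) / (ln (max (exp 1) (real d / (\<beta> * lam)))) powr (3/2)) \<le> real n"
  proof (rule ccontr)
    assume "\<not> ?thesis"
    then have "real n < 1/250 * ((sqrt (real d) / lam) / L powr (3/2))" by (simp add: L_def)
    then have "250 * real n * lam * L powr (3/2) < sqrt (real d)"
      using lam L1 by (simp add: field_simps)
    then have "(250 * real n * lam * L powr (3/2))\<^sup>2 < (sqrt (real d))\<^sup>2"
      using lam by (intro power_strict_mono) auto
    moreover have "(L powr (3/2))\<^sup>2 = L ^ 3"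
    proof -
      have "(L powr (3/2))\<^sup>2 = L powr (3/2 + 3/2)" by (simp only: power2_eq_square powr_add)
      also have "\<dots> = L powr 3" by simp
      also have "\<dots> = L ^ 3" using L1 by (intro powr_numeral) simp
      finally show ?thesis .
    qed
    ultimately have big: "62500 * (real n)\<^sup>2 * lam\<^sup>2 * L ^ 3 < real d"
      by (simp add: power_mult_distrib)
    have n1: "1 \<le> real n" using n by simp
    have "real n * lam * 1 \<le> (real n)\<^sup>2 * lam\<^sup>2 * L ^ 3"
      using n1 lam L1 by (intro mult_mono self_le_power one_le_power) auto
    moreover have "0 \<le> real n * lam" using lam by simp
    ultimately have "16 * real n * lam \<le> real d" using big by linarith
    then have "16 * real n / \<beta> \<le> real d / (\<beta> * lam)"
      using \<beta> lam by (simp add: field_simps)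
    \<comment> \<open>An exponential with exponent at most -L is therefore at most \<beta>/(16n);
      what remains is to show that both exponents reach L.\<close>
    then have e16: "16 * real n / \<beta> \<le> exp L" unfolding expL by linarith
    have "real n \<le> 16 * real n / \<beta>" using \<beta> n1 mult_mono[of \<beta> 16 "real n" "real n"] by (simp add: le_divide_eq mult.commute)
    then have "real n \<le> exp L" using e16 by linarith
    then have "ln (real n) \<le> L" using ln_mono[of "real n" "exp L"] n1 by simp
    \<comment> \<open>The harmonic number enters squared; with the factor L required of the exponent
      this gives L^3, whose square root is the power 3/2 of the logarithm.\<close>
    then have H2: "H \<le> 2 * L" using harm_le_1_ln[OF n] L1 unfolding H_def by linarith
    have H1: "1 \<le> H" unfolding H_def by (rule harm_ge_1[OF n])
    have lam2: "1 \<le> lam\<^sup>2" using lam by simp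
    have \<rho>: "0 < \<rho>" "120 * \<rho> * lam\<^sup>2 \<le> 1" using lam by (auto simp: \<rho>_def)
    have \<rho>_half: "\<rho> \<le> 1/2" unfolding \<rho>_def using lam2 by (intro divide_left_mono) linarith+
    define h where "h = marked_score n \<rho>"
    have h: "\<rho> / (real (Suc n) * H) \<le> h" unfolding h_def H_def
      using marked_score_bounds(1)[OF n _ \<rho>_half] \<rho>(1) by simp
    have LN: "L * (32 * (real (Suc n))\<^sup>2 * H\<^sup>2) \<le> \<rho> * real d"
    proof -
      have "120 * lam\<^sup>2 * (L * (32 * (real (Suc n))\<^sup>2 * H\<^sup>2)) \<le> 120 * lam\<^sup>2 * (L * (32 * (2 * real n)\<^sup>2 * (2 * L)\<^sup>2))"
        using H1 H2 n1 L1 by (intro mult_left_mono mult_mono power_mono) auto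
      also have "\<dots> = 61440 * ((real n)\<^sup>2 * lam\<^sup>2 * L ^ 3)"
        by (simp add: power2_eq_square power3_eq_cube)
      also have "\<dots> \<le> 62500 * ((real n)\<^sup>2 * lam\<^sup>2 * L ^ 3)" using L1 by (intro mult_right_mono) auto
      also have "\<dots> \<le> real d" using big by (simp add: mult_ac)
      finally show ?thesis using lam by (simp add: \<rho>_def le_divide_eq mult_ac)
    qed
    have NH: "0 < real (Suc n) * H" using H1 by simp
    have "L * (32 * \<rho>) \<le> h\<^sup>2 * real d"
    proof -
      have "L * (32 * \<rho>) = \<rho> / (real (Suc n) * H)\<^sup>2 * (L * (32 * (real (Suc n))\<^sup>2 * H\<^sup>2))"
        using H1 by (simp add: power_mult_distrib del: of_nat_Suc)
      also have "\<dots> \<le> \<rho> / (real (Suc n) * H)\<^sup>2 * (\<rho> * real d)"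
        using LN \<rho>(1) by (intro mult_left_mono) auto
      also have "\<dots> = (\<rho> / (real (Suc n) * H))\<^sup>2 * real d"
        by (simp add: power_divide power2_eq_square)
      also have "\<dots> \<le> h\<^sup>2 * real d"
        using h NH \<rho>(1) by (intro mult_right_mono power_mono) (auto simp del: of_nat_Suc)
      finally show ?thesis .
    qed
    then have ex1: "L \<le> h\<^sup>2 * real d / (32 * \<rho>)" using \<rho>(1) by (simp add: le_divide_eq)
    have "L * 1 \<le> L * (32 * (real (Suc n))\<^sup>2 * H\<^sup>2)"
    proof (rule mult_left_mono)
      have "1 * 1 * 1 \<le> 32 * (real (Suc n))\<^sup>2 * H\<^sup>2"
        using H1 n1 by (intro mult_mono one_le_power) auto
      then show "1 \<le> 32 * (real (Suc n))\<^sup>2 * H\<^sup>2" by simp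
    qed (use L1 in simp)
    then have ex2: "L \<le> \<rho> * real d" using LN by simp
    have small: "exp (- x) \<le> \<beta> / (16 * real n)" if "L \<le> x" for x
    proof -
      have "exp (- x) \<le> exp (- L)" using that by simp
      also have "\<dots> \<le> \<beta> / (16 * real n)"
        using le_imp_inverse_le[OF e16] n1 \<beta> by (simp add: exp_minus)
      finally show ?thesis .
    qed
    have "\<beta> \<le> (3 * real n + 1) * exp (- (h\<^sup>2 * real d / (32 * \<rho>))) + real n * (\<beta> / (4 * real n))
     + exp (- \<rho> * real d)"
      unfolding h_def using dp \<beta>
      by (intro fingerprinting_bound[OF n lam \<beta>(2) est _ _ \<rho>(1,2)]) auto
    \<comment> \<open>Here 3n + 1 is at most 4n; the three terms add up to at most 9/16 of \<beta>,
      a contradiction.\<close>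
    also have "\<dots> \<le> (4 * real n) * (\<beta> / (16 * real n)) + real n * (\<beta> / (4 * real n)) + \<beta> / (16 * real n)"
      using small[OF ex1] small[OF ex2] n1 \<beta> by (intro add_mono mult_mono) auto
    also have "\<dots> \<le> \<beta> / 4 + \<beta> / 4 + \<beta> / 16"
      using n1 \<beta> by (auto simp: divide_simps)
    finally show False using \<beta> by simp
  qed
qed simp

end
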